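(* Let $W_1\in\mathrm{P}(n)$ and $N\in\mathrm{D}(n)$. Expressed in the variable $\Sigma=W^{-1}$, the flow $$\dot W=\frac12[W,[W^{-1},N]],\qquad W(0)\in\mathrm{Orb}(W_1),$$ takes the double bracket form $$\dot\Sigma=\frac12[\Sigma,[\Sigma,N]].$$
   Context: $\mathrm{P}(n)$ is the set of real symmetric positive definite $n\times n$ matrices, $\mathrm{D}(n)\subset\mathrm{P}(n)$ the set of diagonal matrices with positive entries, $[A,B]=AB-BA$, and $\mathrm{Orb}(W_1)=\{Q^\top W_1Q\mid Q\in\mathrm{O}(n)\}$. In the paper the flow for $W$ is called the entropy gradient flow on $\mathrm{Orb}(W_1)$ for the entropy relative to $N$. *)

theory Defs
  imports "HOL-Analysis.Analysis"
begin

definition commutator :: "real^'n^'n \<Rightarrow> real^'n^'n \<Rightarrow> real^'n^'n" where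
  "commutator A B = A ** B - B ** A"

definition pos_def_matrices :: "(real^'n^'n) set" where
  "pos_def_matrices = {A. transpose A = A \<and> (\<forall>x. x \<noteq> 0 \<longrightarrow> x \<bullet> (A *v x) > 0)}"

definition pos_diag_matrices :: "(real^'n^'n) set" where
  "pos_diag_matrices = {A. (\<forall>i j. i \<noteq> j \<longrightarrow> A $ i $ j = 0) \<and> (\<forall>i. A $ i $ i > 0)}"

definition orbit :: "real^'n^'n \<Rightarrow> (real^'n^'n) set" where
  "orbit A = {transpose Q ** A ** Q | Q. orthogonal_matrix Q}"

end

theory Submission
  imports Defs
begin

text \<open>
  The derivative prescribed by the flow is always of Lax form \<open>[W, Y]\<close>, even where \<open>W\<close> is singular
  and \<^const>\<open>matrix_inv\<close> has a junk value. Differentiating \<open>det\<close> along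
  \<open>(1 - sY) W (1 + sY)\<close>, whose determinant is an even function of \<open>s\<close> times \<open>det W\<close>, shows that
  \<open>det\<close> is stationary in the direction \<open>[W, Y]\<close>. So \<open>det W\<close> is constant along the flow, and \<open>W\<close> stays
  invertible. The two equations are then exchanged by \<open>(W\<^sup>-\<^sup>1)' = - W\<^sup>-\<^sup>1 W' W\<^sup>-\<^sup>1\<close>.
\<close>

section \<open>Algebra of the matrix product and of the inverse\<close>

lemma bounded_bilinear_matrix_mult:
  "bounded_bilinear ((**) :: real^'n^'m \<Rightarrow> real^'k^'n \<Rightarrow> real^'k^'m)"
  unfolding bilinear_conv_bounded_bilinear[symmetric] bilinear_def
  by (auto intro!: linearI simp: matrix_add_ldistrib matrix_matrix_mult_def vec_eq_iff
      sum.distrib sum_distrib_left algebra_simps)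

lemma matrix_mult_scaleR_left: "(c *\<^sub>R A) ** B = c *\<^sub>R (A ** B)"
  for A :: "real^'n^'m" and B :: "real^'k^'n"
  by (rule bounded_bilinear.scaleR_left[OF bounded_bilinear_matrix_mult])

lemma matrix_mult_scaleR_right: "A ** (c *\<^sub>R B) = c *\<^sub>R (A ** B)"
  for A :: "real^'n^'m" and B :: "real^'k^'n"
  by (rule bounded_bilinear.scaleR_right[OF bounded_bilinear_matrix_mult])

lemma matrix_mult_diff_left: "(A - B) ** C = A ** C - B ** C"
  for A B :: "real^'n^'m" and C :: "real^'k^'n"
  by (rule bounded_bilinear.diff_left[OF bounded_bilinear_matrix_mult])

lemma matrix_mult_diff_right: "A ** (B - C) = A ** B - A ** C"
  for A :: "real^'n^'m" and B C :: "real^'k^'n"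
  by (rule bounded_bilinear.diff_right[OF bounded_bilinear_matrix_mult])

lemma matrix_inv_left_right:
  fixes A :: "real^'n^'n"
  assumes "invertible A"
  shows "A ** matrix_inv A = mat 1" "matrix_inv A ** A = mat 1"
  using someI_ex[OF assms[unfolded invertible_def]] by (simp_all add: matrix_inv_def)

lemma matrix_inv_eqI:
  fixes A B :: "real^'n^'n"
  assumes "A ** B = mat 1"
  shows "matrix_inv A = B"
proof -
  have "invertible A"
    using assms invertible_right_inverse by blast
  then have "matrix_inv A = matrix_inv A ** (A ** B)"
    by (simp add: assms)
  also have "\<dots> = B"
    using \<open>invertible A\<close> by (simp add: matrix_mul_assoc matrix_inv_left_right)
  finally show ?thesis .
qed

lemma matrix_inv_invertible:
  fixes A :: "real^'n^'n"
  assumes "invertible A"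
  shows "invertible (matrix_inv A)" "matrix_inv (matrix_inv A) = A"
  using matrix_inv_left_right[OF assms] by (auto simp: invertible_def intro: matrix_inv_eqI)

section \<open>Calculus of the determinant and of inversion\<close>

lemma tendsto_det:
  fixes A :: "'a \<Rightarrow> real^'n^'n"
  assumes "(A \<longlongrightarrow> L) F"
  shows "((\<lambda>x. det (A x)) \<longlongrightarrow> det L) F"
  unfolding det_def by (intro tendsto_intros assms)

lemma differentiable_det: "(det :: real^'n^'n \<Rightarrow> real) differentiable at A"
proof -
  have nth: "((\<lambda>A :: real^'n^'n. A $ i $ j) has_derivative (\<lambda>A. A $ i $ j)) (at A)" for i j
    by (intro bounded_linear_imp_has_derivative bounded_linear_compose[OF bounded_linear_vec_nth]
        bounded_linear_vec_nth)
  show ?thesis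
    unfolding differentiable_def det_def
    by (rule exI) (rule has_derivative_sum has_derivative_mult_right has_derivative_prod nth)+
qed

text \<open>Cramer's rule for \<open>A x = axis j 1\<close>, whose solution is column
  \<open>j\<close> of the inverse. Entries become quotients of determinants, so continuity of
  inversion reduces to continuity of \<open>det\<close>.\<close>

lemma matrix_inv_nth:
  fixes A :: "real^'n^'n"
  assumes "invertible A"
  shows "matrix_inv A $ k $ j =
    det (\<chi> i l. if l = k then axis j 1 $ i else A $ i $ l) / det A"
proof -
  have "A *v (matrix_inv A *v axis j 1) = axis j 1"
    by (simp add: matrix_vector_mul_assoc matrix_inv_left_right assms)
  then have "matrix_inv A *v axis j 1 =
      (\<chi> k. det (\<chi> i l. if l = k then axis j 1 $ i else A $ i $ l) / det A)"
    using cramer assms invertible_det_nz by blast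
  moreover have "matrix_inv A $ k $ j = (matrix_inv A *v axis j 1) $ k"
    by (simp add: matrix_vector_mul_component inner_axis)
  ultimately show ?thesis by simp
qed

lemma tendsto_matrix_inv:
  fixes A :: "'a \<Rightarrow> real^'n^'n"
  assumes lim: "(A \<longlongrightarrow> L) F" and L: "invertible L" and inv: "\<forall>\<^sub>F x in F. invertible (A x)"
  shows "((\<lambda>x. matrix_inv (A x)) \<longlongrightarrow> matrix_inv L) F"
proof (intro vec_tendstoI)
  fix k j
  let ?c = "\<lambda>A :: real^'n^'n. det (\<chi> i l. if l = k then axis j 1 $ i else A $ i $ l) / det A"
  have "((\<lambda>x. if l = k then axis j 1 $ i else A x $ i $ l)
      \<longlongrightarrow> (if l = k then axis j 1 $ i else L $ i $ l)) F" for i l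
    using tendsto_vec_nth[OF tendsto_vec_nth[OF lim]] by auto
  then have "((\<lambda>x. ?c (A x)) \<longlongrightarrow> ?c L) F"
    using L by (intro tendsto_divide tendsto_det tendsto_vec_lambda lim)
      (simp_all add: invertible_det_nz)
  moreover have "\<forall>\<^sub>F x in F. ?c (A x) = matrix_inv (A x) $ k $ j"
    using inv by eventually_elim (simp add: matrix_inv_nth)
  ultimately show "((\<lambda>x. matrix_inv (A x) $ k $ j) \<longlongrightarrow> matrix_inv L $ k $ j) F"
    unfolding matrix_inv_nth[OF L] by (rule Lim_transform_eventually)
qed

text \<open>Turns a derivative into a limit of difference quotients, so that the derivative of the
  inverse comes from limit rules alone.\<close>

lemma has_vector_derivative_iff_quotient:
  "(f has_vector_derivative D) (at x within S) \<longleftrightarrow>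
    ((\<lambda>y. (1 / (y - x)) *\<^sub>R (f y - f x)) \<longlongrightarrow> D) (at x within S)"
proof -
  have "norm (f y - f x - (y - x) *\<^sub>R D) / norm (y - x)
      = norm ((1 / (y - x)) *\<^sub>R (f y - f x) - D)" if "y \<noteq> x" for y
  proof -
    have "(1 / (y - x)) *\<^sub>R (f y - f x) - D = (1 / (y - x)) *\<^sub>R (f y - f x - (y - x) *\<^sub>R D)"
      using that by (simp add: scaleR_diff_right)
    then show ?thesis
      by (simp add: divide_inverse mult.commute)
  qed
  then have "((\<lambda>y. norm (f y - f x - (y - x) *\<^sub>R D) / norm (y - x)) \<longlongrightarrow> 0) (at x within S)
      \<longleftrightarrow> ((\<lambda>y. norm ((1 / (y - x)) *\<^sub>R (f y - f x) - D)) \<longlongrightarrow> 0) (at x within S)"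
    by (intro Lim_cong_within) auto
  then show ?thesis
    by (simp add: has_vector_derivative_def has_derivative_iff_norm bounded_linear_scaleR_left
        tendsto_norm_zero_iff LIM_zero_iff)
qed

lemma has_vector_derivative_matrix_inv:
  fixes A :: "real \<Rightarrow> real^'n^'n"
  assumes der: "(A has_vector_derivative D) (at t within T)"
    and t: "t \<in> T" and inv: "\<And>s. s \<in> T \<Longrightarrow> invertible (A s)"
  shows "((\<lambda>s. matrix_inv (A s)) has_vector_derivative
    - (matrix_inv (A t) ** D ** matrix_inv (A t))) (at t within T)"
proof -
  note tendsto_mult = bounded_bilinear.tendsto[OF bounded_bilinear_matrix_mult]
  let ?V = "\<lambda>s. matrix_inv (A s)"
  have "(A \<longlongrightarrow> A t) (at t within T)"
    using has_vector_derivative_continuous[OF der] by (simp add: continuous_within)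
  \<comment> \<open>The filter \<open>at t within T\<close> sees only points of \<open>T\<close>,
    where \<open>A\<close> is invertible.\<close>
  then have V: "(?V \<longlongrightarrow> ?V t) (at t within T)"
    using inv t by (intro tendsto_matrix_inv) (auto simp: eventually_at_filter)
  have "((\<lambda>s. (1 / (s - t)) *\<^sub>R (A s - A t)) \<longlongrightarrow> D) (at t within T)"
    using der by (simp add: has_vector_derivative_iff_quotient)
  then have "((\<lambda>s. - (?V s ** ((1 / (s - t)) *\<^sub>R (A s - A t)) ** ?V t))
      \<longlongrightarrow> - (?V t ** D ** ?V t)) (at t within T)"
    by (intro tendsto_minus tendsto_mult tendsto_const V)
  moreover have "- (?V s ** ((1 / (s - t)) *\<^sub>R (A s - A t)) ** ?V t)
      = (1 / (s - t)) *\<^sub>R (?V s - ?V t)" if "s \<in> T" for s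
  proof -
    \<comment> \<open>Resolvent-type identity: it turns the difference of inverses into the
      difference of \<open>A\<close> between two inverse factors, one at \<open>s\<close> and one at
      \<open>t\<close>.\<close>
    have "?V s ** (A s - A t) ** ?V t = ?V s ** A s ** ?V t - ?V s ** (A t ** ?V t)"
      by (simp add: matrix_mult_diff_left matrix_mult_diff_right matrix_mul_assoc)
    also have "\<dots> = ?V t - ?V s"
      using inv t that by (simp add: matrix_inv_left_right)
    finally have "?V s ** (A s - A t) ** ?V t = ?V t - ?V s" .
    then show ?thesis
      by (simp add: matrix_mult_scaleR_left matrix_mult_scaleR_right flip: scaleR_minus_right)
  qed
  then have "\<forall>\<^sub>F s in at t within T. - (?V s ** ((1 / (s - t)) *\<^sub>R (A s - A t)) ** ?V t)
      = (1 / (s - t)) *\<^sub>R (?V s - ?V t)"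
    by (simp add: eventually_at_filter)
  ultimately show ?thesis
    unfolding has_vector_derivative_iff_quotient by (rule Lim_transform_eventually)
qed

section \<open>Isospectral flows and invertibility\<close>

lemma has_derivative_det_commutator:
  fixes A Y :: "real^'n^'n"
  assumes det': "(det has_derivative det') (at A)"
  shows "det' (commutator A Y) = 0"
proof -
  \<comment> \<open>\<open>c\<close> passes through \<open>A\<close> at \<open>0\<close> with
    velocity \<open>A ** Y - Y ** A\<close>; by multiplicativity
    \<open>det (c s) = g s * det A\<close>.\<close>
  define g where "g s = det (mat 1 - s *\<^sub>R Y) * det (mat 1 + s *\<^sub>R Y)" for s
  define c where "c s = (mat 1 - s *\<^sub>R Y) ** A ** (mat 1 + s *\<^sub>R Y)" for s
  have "((\<lambda>s. mat 1 - s *\<^sub>R Y) has_vector_derivative - Y) (at 0)"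
    unfolding has_vector_derivative_def by (auto intro!: derivative_eq_intros)
  from bounded_linear.has_vector_derivative[OF
      bounded_bilinear.bounded_linear_left[OF bounded_bilinear_matrix_mult, of A] this]
  have "((\<lambda>s. (mat 1 - s *\<^sub>R Y) ** A) has_vector_derivative - Y ** A) (at 0)" .
  moreover have "((\<lambda>s. mat 1 + s *\<^sub>R Y) has_vector_derivative Y) (at 0)"
    unfolding has_vector_derivative_def by (auto intro!: derivative_eq_intros)
  ultimately have "(c has_vector_derivative
      (mat 1 - 0 *\<^sub>R Y) ** A ** Y + - Y ** A ** (mat 1 + 0 *\<^sub>R Y)) (at 0)"
    unfolding c_def by (rule bounded_bilinear.has_vector_derivative[OF bounded_bilinear_matrix_mult])
  then have "(c has_vector_derivative commutator A Y) (at 0)"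
    by (simp add: commutator_def bounded_bilinear.minus_left[OF bounded_bilinear_matrix_mult])
  then have "((det \<circ> c) has_derivative det' \<circ> (\<lambda>s. s *\<^sub>R commutator A Y)) (at 0)"
    using det' by (intro diff_chain_at) (simp_all add: has_vector_derivative_def c_def)
  then have d: "((\<lambda>s. g s * det A) has_derivative det' \<circ> (\<lambda>s. s *\<^sub>R commutator A Y)) (at 0)"
    by (simp add: c_def g_def det_mul o_def mult_ac)
  have "linear det'"
    using det' has_derivative_linear by blast
  then have pos: "((\<lambda>s. g s * det A) has_field_derivative det' (commutator A Y)) (at 0)"
    unfolding has_field_derivative_def
    by (intro has_derivative_eq_rhs[OF d]) (auto simp: linear_cmul)
  then have "((\<lambda>s. g (- s) * det A) has_field_derivative - det' (commutator A Y)) (at 0)"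
    using DERIV_mirror[of "\<lambda>s. g s * det A" _ 0] by simp
  \<comment> \<open>The reflection of \<open>s\<close> swaps the two factors of \<open>g\<close>.
    The derivative at \<open>0\<close> thus equals its own negative.\<close>
  moreover have "g (- s) = g s" for s
    by (simp add: g_def)
  ultimately have "((\<lambda>s. g s * det A) has_field_derivative - det' (commutator A Y)) (at 0)"
    by simp
  with pos have "det' (commutator A Y) = - det' (commutator A Y)"
    by (rule DERIV_unique)
  then show ?thesis by simp
qed

text \<open>By the chain rule \<open>det (W t)\<close> has zero derivative on a convex set.
  \<open>Y\<close> is arbitrary, so the lemma applies before \<open>matrix_inv (W t)\<close> is
  known to be a genuine inverse.\<close>

lemma isospectral_flow_det_const:
  fixes W :: "real \<Rightarrow> real^'n^'n"
  assumes "\<And>t. t \<in> T \<Longrightarrow> (W has_vector_derivative commutator (W t) (Y t)) (at t within T)"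
    and "convex T" "s \<in> T" "t \<in> T"
  shows "det (W s) = det (W t)"
proof -
  have "((\<lambda>t. det (W t)) has_derivative (\<lambda>h. 0)) (at t within T)" if t: "t \<in> T" for t
  proof -
    obtain det' where det': "(det has_derivative det') (at (W t))"
      using differentiable_det differentiable_def by blast
    have "((\<lambda>t. det (W t)) has_derivative (\<lambda>h. det' (h *\<^sub>R commutator (W t) (Y t)))) (at t within T)"
      using has_derivative_compose[OF assms(1)[OF t, unfolded has_vector_derivative_def] det'] .
    moreover have "det' (h *\<^sub>R commutator (W t) (Y t)) = 0" for h
      using has_derivative_det_commutator[OF det'] has_derivative_linear[OF det']
      by (simp add: linear_cmul)
    ultimately show ?thesis by simp
  qed
  then have "\<exists>k. \<forall>t\<in>T. det (W t) = k"
    by (intro has_derivative_zero_constant[OF \<open>convex T\<close>])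
  then show ?thesis using assms(3,4) by auto
qed

text \<open>Positive definiteness forces a trivial kernel, and orthogonal factors have determinant 1
  or -1.\<close>

lemma invertible_orbit_pos_def:
  assumes "A \<in> pos_def_matrices" and "B \<in> orbit A"
  shows "invertible B"
proof -
  have "x = 0" if "A *v x = 0" for x
    using assms(1) that by (force simp: pos_def_matrices_def)
  then have "invertible A"
    using matrix_left_invertible_ker invertible_left_inverse by blast
  moreover obtain Q where "B = transpose Q ** A ** Q" "orthogonal_matrix Q"
    using assms(2) by (auto simp: orbit_def)
  ultimately show ?thesis
    by (metis det_orthogonal_matrix det_transpose invertible_det_nz invertible_mult zero_neq_one
        zero_neq_neg_one)
qed

section \<open>Lax equations under inversion\<close>

lemma commutator_scaleR_right: "commutator A (c *\<^sub>R B) = c *\<^sub>R commutator A B"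
  by (simp add: commutator_def matrix_mult_scaleR_left matrix_mult_scaleR_right scaleR_diff_right)

text \<open>Multiplying by \<open>B\<close> on both sides cancels one \<open>A\<close> in each term
  and leaves \<open>Y ** B - B ** Y\<close>; the sign from differentiating an inverse restores the
  order.\<close>

lemma inverse_commutator_inverse:
  assumes "A ** B = mat 1" "B ** A = mat 1"
  shows "- (B ** commutator A Y ** B) = commutator B Y"
proof -
  have "B ** commutator A Y ** B = (B ** A) ** Y ** B - B ** Y ** (A ** B)"
    by (simp add: commutator_def matrix_mult_diff_left matrix_mult_diff_right matrix_mul_assoc)
  then show ?thesis
    by (simp add: assms commutator_def)
qed

text \<open>Inversion keeps the same generator \<open>Y\<close>, so this serves both directions of
  the theorem.\<close>

lemma has_vector_derivative_matrix_inv_commutator: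
  fixes A :: "real \<Rightarrow> real^'n^'n"
  assumes "(A has_vector_derivative commutator (A t) Y) (at t within T)"
    and "t \<in> T" and inv: "\<And>s. s \<in> T \<Longrightarrow> invertible (A s)"
  shows "((\<lambda>s. matrix_inv (A s)) has_vector_derivative commutator (matrix_inv (A t)) Y)
    (at t within T)"
  using has_vector_derivative_matrix_inv[OF assms]
    inverse_commutator_inverse[OF matrix_inv_left_right[OF inv[OF \<open>t \<in> T\<close>]]]
  by simp

text \<open>Invertibility stands on the right because \<open>matrix_inv\<close> is unspecified at
  singular matrices: with it, \<open>W\<close> is recovered from its inverse.\<close>

theorem corollary2:
  fixes W1 N :: "real^'n^'n" and W :: "real \<Rightarrow> real^'n^'n" and T :: "real set"
  assumes "W1 \<in> pos_def_matrices"
    and "N \<in> pos_diag_matrices"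
    and "is_interval T" and "0 \<in> T"
    and "W 0 \<in> orbit W1"
  shows "(\<forall>t\<in>T. (W has_vector_derivative
             (1/2) *\<^sub>R commutator (W t) (commutator (matrix_inv (W t)) N)) (at t within T))
    \<longleftrightarrow>
     (\<forall>t\<in>T. invertible (W t)) \<and>
     (\<forall>t\<in>T. ((\<lambda>s. matrix_inv (W s)) has_vector_derivative
             (1/2) *\<^sub>R commutator (matrix_inv (W t)) (commutator (matrix_inv (W t)) N)) (at t within T))"
proof -
  \<comment> \<open>The common generator: with the factor 1/2 moved inside, both equations are Lax
    equations for this \<open>Y\<close>.\<close>
  define Y where "Y t = (1/2) *\<^sub>R commutator (matrix_inv (W t)) N" for t
  let ?V = "\<lambda>s. matrix_inv (W s)"
  have "(\<forall>t\<in>T. (W has_vector_derivative commutator (W t) (Y t)) (at t within T)) \<longleftrightarrow>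
      (\<forall>t\<in>T. invertible (W t)) \<and>
      (\<forall>t\<in>T. (?V has_vector_derivative commutator (?V t) (Y t)) (at t within T))"
    (is "?flow \<longleftrightarrow> ?inv \<and> ?double_bracket")
  proof (intro iffI conjI)
    assume flow: ?flow
    have "det (W t) = det (W 0)" if "t \<in> T" for t
      using flow that assms
      by (intro isospectral_flow_det_const[where T = T and Y = Y]) (auto simp: is_interval_convex)
    moreover have "invertible (W 0)"
      using assms invertible_orbit_pos_def by blast
    ultimately show ?inv
      by (simp add: invertible_det_nz)
    then show ?double_bracket
      using flow has_vector_derivative_matrix_inv_commutator by blast
  next
    assume *: "?inv \<and> ?double_bracket"
    show ?flow
    proof
      fix t assume t: "t \<in> T"
      \<comment> \<open>Inverting the curve of inverses leads back to \<open>W\<close>.\<close>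
      have "((\<lambda>s. matrix_inv (?V s)) has_vector_derivative commutator (matrix_inv (?V t)) (Y t))
          (at t within T)"
        using * t by (intro has_vector_derivative_matrix_inv_commutator[where A = ?V])
          (simp_all add: matrix_inv_invertible(1))
      then have "((\<lambda>s. matrix_inv (?V s)) has_vector_derivative commutator (W t) (Y t)) (at t within T)"
        using * t by (simp add: matrix_inv_invertible(2))
      then show "(W has_vector_derivative commutator (W t) (Y t)) (at t within T)"
        \<comment> \<open>The double inverse is known to equal \<open>W\<close> only on
          \<open>T\<close>, which suffices for a derivative within \<open>T\<close>.\<close>
        using * by (rule_tac has_vector_derivative_transform[OF t])
          (simp_all add: matrix_inv_invertible(2))
    qed
  qed
  then show ?thesis
    by (simp add: Y_def commutator_scaleR_right)
qed

end
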